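(* Fix a design parameter vector $d$. Let $Q$ be an $\mathbb{R}^n$-valued and $Y_d$ an $\mathbb{R}^m$-valued random variable, both with finite variance. Let $\mathcal{S}'=\{f(\cdot;\theta):\theta\in\mathbb{R}^\beta\}$ be a parameterized, finite-dimensional subset of the set $\mathcal{S}$ of functions $f:\mathbb{R}^m\to\mathbb{R}^n$ for which $f(Y_d)$ has finite variance. Let $f^*=f(\cdot;\theta^* )\in\mathcal{S}'$ be a minimizer of $\mathcal{M}(f)=\operatorname{E}[\lVert Q-f(Y_d)\rVert_2^2]$ over $\mathcal{S}'$, and let $D_N$, $D_M$ be statistically independent datasets of $N$, respectively $M$, i.i.d. samples of $(Q,Y_d)$. Assume: (1) $\mathcal{S}'$ is a convex set that contains the constant functions; (2) $\operatorname{Var}\bigl[\lVert Q-f^*(Y_d)\rVert_2^2\bigr]=\mathcal{O}\bigl(2\,\operatorname{E}[\lVert Q-f^*(Y_d)\rVert_2^2]^2\bigr)<\infty$; (3) the optimization error $\epsilon_{\mathrm{opt}}=\operatorname{E}\bigl[\lvert\mathcal{M}(f(\cdot;\theta_{D_N}))-\mathcal{M}(f^* )\rvert\bigr]$ satisfies $$\epsilon_{\mathrm{opt}}=\mathcal{O}\Bigl(\operatorname{E}\bigl[\lvert\widehat{\mathcal{M}}(f^*\mid D_N)-\mathcal{M}(f^* )\rvert\bigr]\Bigr).$$ Then the mean absolute error of the estimator $\widehat V_d(D_N,D_M)=\widehat{\mathcal{M}}(f(\cdot;\theta_{D_N})\mid D_M)$ of $V_d=\operatorname{E}[\lVert Q-\operatorname{E}[Q\mid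 Y_d]\rVert_2^2]$ satisfies, as $N,M\to\infty$, $$\operatorname{E}\bigl[\lvert\widehat V_d(D_N,D_M)-V_d\rvert\bigr]=\mathcal{O}\Bigl(\Bigl(\frac{2}{\sqrt{\pi N}}+\frac{2}{\sqrt{\pi M}}\Bigr)\operatorname{E}\bigl[\lVert Q-f^*(Y_d)\rVert_2^2\bigr]\Bigr)+\epsilon_{S'},$$ where $\epsilon_{S'}=\lvert\mathcal{M}(f^* )-\mathcal{M}(\phi_d)\rvert$ is the approximation error due to the choice of $\mathcal{S}'$.
   Context: Setting: $Y_d=h(Q,d)+\Xi$ with a deterministic observational map $h$ and a measurement error $\Xi$; samples of $(Q,Y_d)$ are generated as $(q^{(i)},h(q^{(i)},d)+\xi^{(i)})$ with $q^{(i)}$, $\xi^{(i)}$ i.i.d. samples of $Q$ and $\Xi$. $\lVert\cdot\rVert_2$ is the Euclidean norm. For a dataset $D$ of sample pairs with cardinality $|D|$, the crude Monte Carlo estimator of $\mathcal{M}(f)$ is $$\widehat{\mathcal{M}}(f\mid D)=\frac1{|D|}\sum_{(q,y)\in D}\lVert q-f(y)\rVert_2^2 .$$ The parameter vector $\theta_{D_N}$ is a minimizer of $\theta\mapsto\widehat{\mathcal{M}}(f(\cdot;\theta)\mid D_N)$. It is random through $D_N$, and $\mathcal{M}(f(\cdot;\theta_{D_N}))$ denotes $\mathcal{M}(f(\cdot;\theta))$ evaluated at $\theta=\theta_{D_N}$ (i.e. the expectation defining $\mathcal{M}$ is over $(Q,Y_d)$ independent of $D_N$). $\phi_d:\mathbb{R}^m\to\mathbb{R}^n$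 is the map with $\operatorname{E}[Q\mid Y_d]=\phi_d(Y_d)$; it minimizes $\mathcal{M}$ over $\mathcal{S}$, and $V_d=\mathcal{M}(\phi_d)$ is the total expected conditional variance $\sum_{i=1}^n\operatorname{E}[\operatorname{Var}[Q_i\mid Y_d]]$. Meaning of $\mathcal{O}$: $A=\mathcal{O}(B)$ means $|A|\le C\,B$ for a constant $C$ independent of $N$ and $M$ (for all sufficiently large $N$, $M$ where these appear); "$A=\mathcal{O}(B)+\epsilon$" means $A-\epsilon=\mathcal{O}(B)$. *)

theory Defs
  imports "HOL-Probability.Probability" "HOL-Library.Landau_Symbols"
begin

text \<open>On a probability space, square integrability of the norm is the same as integrability of
  \<open>X\<close> together with finiteness of the variance of every component.\<close>

definition finite_variance ::
    "'a measure \<Rightarrow> ('a \<Rightarrow> 'b :: euclidean_space) \<Rightarrow> bool" where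
  "finite_variance P X \<longleftrightarrow>
     X \<in> borel_measurable P \<and> integrable P (\<lambda>\<omega>. (norm (X \<omega>))\<^sup>2)"

definition finite_variance_maps ::
    "'a measure \<Rightarrow> ('a \<Rightarrow> real ^ 'm) \<Rightarrow> (real ^ 'm \<Rightarrow> real ^ 'n) set" where
  "finite_variance_maps P Y =
     {g \<in> borel_measurable borel. finite_variance P (\<lambda>\<omega>. g (Y \<omega>))}"

text \<open>The function type is not an instance of the class of real vector spaces, so the
  library notion of a convex set does not apply to sets of functions.\<close>

definition convex_function_set :: "('y \<Rightarrow> 'z :: real_vector) set \<Rightarrow> bool" where
  "convex_function_set S \<longleftrightarrow>
     (\<forall>g\<in>S. \<forall>h\<in>S. \<forall>u\<ge>0. \<forall>v\<ge>0. u + v = 1 \<longrightarrow> (\<lambda>y. u *\<^sub>R g y + v *\<^sub>R h y) \<in> S)"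

definition mse ::
    "'a measure \<Rightarrow> ('a \<Rightarrow> real ^ 'n) \<Rightarrow> ('a \<Rightarrow> real ^ 'm) \<Rightarrow> (real ^ 'm \<Rightarrow> real ^ 'n) \<Rightarrow> real" where
  "mse P Q Y g = (\<integral>\<omega>. (norm (Q \<omega> - g (Y \<omega>)))\<^sup>2 \<partial>P)"

text \<open>Datasets are lists, so that repeated sample pairs are counted with multiplicity.\<close>

definition mse_hat ::
    "(real ^ 'm \<Rightarrow> real ^ 'n) \<Rightarrow> ((real ^ 'n) \<times> (real ^ 'm)) list \<Rightarrow> real" where
  "mse_hat g D = 1 / real (length D) * (\<Sum>(q, y)\<leftarrow>D. (norm (q - g y))\<^sup>2)"

definition dataset :: "(nat \<Rightarrow> 'a \<Rightarrow> 'z) \<Rightarrow> nat \<Rightarrow> 'a \<Rightarrow> 'z list" where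
  "dataset Z n \<omega> = map (\<lambda>i. Z i \<omega>) [0..<n]"

definition iid_samples ::
    "'a measure \<Rightarrow> ('a \<Rightarrow> 'z :: topological_space) \<Rightarrow> (nat \<Rightarrow> 'a \<Rightarrow> 'z) \<Rightarrow> nat \<Rightarrow> bool" where
  "iid_samples P X Z n \<longleftrightarrow>
     prob_space.indep_vars P (\<lambda>_. borel) Z {..<n} \<and>
     (\<forall>i<n. distr P borel (Z i) = distr P borel X)"

definition indep_datasets ::
    "'a measure \<Rightarrow> (nat \<Rightarrow> 'a \<Rightarrow> 'z :: topological_space) \<Rightarrow> nat \<Rightarrow>
     (nat \<Rightarrow> 'a \<Rightarrow> 'z) \<Rightarrow> nat \<Rightarrow> bool" where
  "indep_datasets P Z n Z' m \<longleftrightarrow>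
     prob_space.indep_var P
       (\<Pi>\<^sub>M i\<in>{..<n}. borel) (\<lambda>\<omega>. \<lambda>i\<in>{..<n}. Z i \<omega>)
       (\<Pi>\<^sub>M j\<in>{..<m}. borel) (\<lambda>\<omega>. \<lambda>j\<in>{..<m}. Z' j \<omega>)"

text \<open>The conditional expectation of a random vector given \<open>Y\<close>, taken componentwise with
  respect to the sigma-algebra generated by \<open>Y\<close>.\<close>

definition cond_exp_given ::
    "'a measure \<Rightarrow> ('a \<Rightarrow> real ^ 'n) \<Rightarrow> ('a \<Rightarrow> real ^ 'm) \<Rightarrow> 'a \<Rightarrow> real ^ 'n" where
  "cond_exp_given P Q Y \<omega> =
     (\<chi> i. real_cond_exp P (vimage_algebra (space P) Y borel) (\<lambda>\<omega>'. Q \<omega>' $ i) \<omega>)"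

definition total_cond_variance ::
    "'a measure \<Rightarrow> ('a \<Rightarrow> real ^ 'n) \<Rightarrow> ('a \<Rightarrow> real ^ 'm) \<Rightarrow> real" where
  "total_cond_variance P Q Y = (\<integral>\<omega>. (norm (Q \<omega> - cond_exp_given P Q Y \<omega>))\<^sup>2 \<partial>P)"

end

theory Submission
  imports Defs
begin

text \<open>By the reverse triangle inequality it suffices to bound the mean distance of the estimator from
  \<open>v = mse f*\<close>. Condition on the training data, so that the fitted map \<open>g\<close> is fixed, and write
  \<open>\<delta> = mse g - v\<close>. With \<open>a = Q - f*(Y)\<close> and \<open>b = f*(Y) - g(Y)\<close> the loss of \<open>g\<close> is
  \<open>|a|^2 + 2 <a, b> + |b|^2\<close>. Convexity makes \<open>E <a, b>\<close> nonnegative, hence \<open>E |b|^2 \<le> \<delta>\<close>. The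
  first term deviates by \<open>O(v / sqrt M)\<close>, the last contributes \<open>O(\<delta>)\<close>, and the cross term, truncated
  where \<open>|a|^2\<close> exceeds \<open>sqrt M * v\<close>, contributes \<open>O(v / sqrt M + \<delta>)\<close>. Averaging over the training
  data turns \<open>\<delta>\<close> into the optimization error, which is \<open>O(v / sqrt N)\<close> by assumption.\<close>

section \<open>Second moments and sums of independent centred variables\<close>

text \<open>The variance of \<open>\<bar>X\<bar>\<close> is nonnegative. This turns every
  second-moment bound below into a bound on a mean absolute deviation.\<close>

lemma (in prob_space) abs_expectation_le_sqrt:
  assumes "random_variable borel X" "integrable M (\<lambda>\<omega>. (X \<omega>)\<^sup>2 :: real)"
  shows "integrable M X" "expectation (\<lambda>\<omega>. \<bar>X \<omega>\<bar>) \<le> sqrt (expectation (\<lambda>\<omega>. (X \<omega>)\<^sup>2))"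
proof -
  show *: "integrable M X"
    using assms by (rule square_integrable_imp_integrable)
  have "0 \<le> variance (\<lambda>\<omega>. \<bar>X \<omega>\<bar>)"
    by (rule variance_positive)
  also have "\<dots> = expectation (\<lambda>\<omega>. (X \<omega>)\<^sup>2) - (expectation (\<lambda>\<omega>. \<bar>X \<omega>\<bar>))\<^sup>2"
    using * assms by (subst variance_eq) auto
  finally show "expectation (\<lambda>\<omega>. \<bar>X \<omega>\<bar>) \<le> sqrt (expectation (\<lambda>\<omega>. (X \<omega>)\<^sup>2))"
    by (intro real_le_rsqrt) simp
qed

text \<open>After expanding the square, independence and centring annihilate the off-diagonal
  products, so only the diagonal survives.\<close>

lemma (in prob_space) expectation_sum_indep_centred_square:
  fixes X :: "'i \<Rightarrow> 'a \<Rightarrow> real"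
  assumes I: "finite I" "indep_vars (\<lambda>_. borel) X I"
    and int: "\<And>i. i \<in> I \<Longrightarrow> integrable M (\<lambda>\<omega>. (X i \<omega>)\<^sup>2)"
    and centred: "\<And>i. i \<in> I \<Longrightarrow> expectation (X i) = 0"
  shows "integrable M (\<lambda>\<omega>. (\<Sum>i\<in>I. X i \<omega>)\<^sup>2)"
    and "expectation (\<lambda>\<omega>. (\<Sum>i\<in>I. X i \<omega>)\<^sup>2) = (\<Sum>i\<in>I. expectation (\<lambda>\<omega>. (X i \<omega>)\<^sup>2))"
proof -
  have rv: "random_variable borel (X i)" if "i \<in> I" for i
    using I that by (auto simp: indep_vars_def)
  have int1: "integrable M (X i)" if "i \<in> I" for i
    using rv int that abs_expectation_le_sqrt(1) by blast
  have prod: "integrable M (\<lambda>\<omega>. X i \<omega> * X j \<omega>)"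
    "expectation (\<lambda>\<omega>. X i \<omega> * X j \<omega>) = (if i = j then expectation (\<lambda>\<omega>. (X i \<omega>)\<^sup>2) else 0)"
    if "i \<in> I" "j \<in> I" for i j
  proof -
    have "integrable M (\<lambda>\<omega>. X i \<omega> * X j \<omega>) \<and>
      expectation (\<lambda>\<omega>. X i \<omega> * X j \<omega>) = (if i = j then expectation (\<lambda>\<omega>. (X i \<omega>)\<^sup>2) else 0)"
    proof (cases "i = j")
      case True
      then show ?thesis using int that by (simp add: power2_eq_square)
    next
      case False
      have ind: "indep_vars (\<lambda>_. borel) X {i, j}"
        using indep_vars_subset[OF I(2)] that by auto
      from indep_vars_integrable[OF _ ind] indep_vars_lebesgue_integral[OF _ ind] that False int1 centred
      show ?thesis by auto
    qed
    then show "integrable M (\<lambda>\<omega>. X i \<omega> * X j \<omega>)"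
      "expectation (\<lambda>\<omega>. X i \<omega> * X j \<omega>) = (if i = j then expectation (\<lambda>\<omega>. (X i \<omega>)\<^sup>2) else 0)"
      by blast+
  qed
  show "integrable M (\<lambda>\<omega>. (\<Sum>i\<in>I. X i \<omega>)\<^sup>2)"
    unfolding power2_eq_square sum_product using prod by (intro Bochner_Integration.integrable_sum) auto
  have "expectation (\<lambda>\<omega>. (\<Sum>i\<in>I. X i \<omega>)\<^sup>2) = (\<Sum>i\<in>I. \<Sum>j\<in>I. expectation (\<lambda>\<omega>. X i \<omega> * X j \<omega>))"
    unfolding power2_eq_square sum_product using prod
    by (subst Bochner_Integration.integral_sum; (intro sum.cong refl
          Bochner_Integration.integral_sum Bochner_Integration.integrable_sum)?) auto
  also have "\<dots> = (\<Sum>i\<in>I. expectation (\<lambda>\<omega>. (X i \<omega>)\<^sup>2))"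
    using prod I(1) by (simp add: sum.delta)
  finally show "expectation (\<lambda>\<omega>. (\<Sum>i\<in>I. X i \<omega>)\<^sup>2) = (\<Sum>i\<in>I. expectation (\<lambda>\<omega>. (X i \<omega>)\<^sup>2))" .
qed

section \<open>Sample means of i.i.d. data\<close>

text \<open>Integrals of \<open>u\<close> along a sample depend only on its law, which is that of
  \<open>X\<close>; moments of samples can thus be computed on \<open>X\<close> itself.\<close>

lemma iid_samples_transfer:
  fixes u :: "'z :: topological_space \<Rightarrow> real"
  assumes iid: "iid_samples P X Z n" and i: "i < n"
    and P: "prob_space P" and X: "X \<in> borel_measurable P" and u: "u \<in> borel_measurable borel"
  shows "Z i \<in> borel_measurable P"
    and "integrable P (\<lambda>\<omega>. u (Z i \<omega>)) \<longleftrightarrow> integrable P (\<lambda>\<omega>. u (X \<omega>))"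
    and "(\<integral>\<omega>. u (Z i \<omega>) \<partial>P) = (\<integral>\<omega>. u (X \<omega>) \<partial>P)"
proof -
  interpret prob_space P by fact
  show Z: "Z i \<in> borel_measurable P"
    using iid i by (auto simp: iid_samples_def indep_vars_def)
  have eq: "distr P borel (Z i) = distr P borel X"
    using iid i by (simp add: iid_samples_def)
  show "integrable P (\<lambda>\<omega>. u (Z i \<omega>)) \<longleftrightarrow> integrable P (\<lambda>\<omega>. u (X \<omega>))"
    using integrable_distr_eq[OF Z u] integrable_distr_eq[OF X u] eq by simp
  show "(\<integral>\<omega>. u (Z i \<omega>) \<partial>P) = (\<integral>\<omega>. u (X \<omega>) \<partial>P)"
    using integral_distr[OF Z u] integral_distr[OF X u] eq by simp
qed

text \<open>The variance of a sample mean is the single-sample variance divided by \<open>n\<close>,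
  and the first absolute moment is at most the root of the second.\<close>

lemma iid_sample_mean_deviation:
  fixes u :: "'z :: topological_space \<Rightarrow> real"
  assumes P: "prob_space P" and iid: "iid_samples P X Z n" and n: "n > 0"
    and X: "X \<in> borel_measurable P" and u: "u \<in> borel_measurable borel"
    and int: "integrable P (\<lambda>\<omega>. (u (X \<omega>))\<^sup>2)"
  shows "(\<integral>\<omega>. \<bar>(\<Sum>i<n. u (Z i \<omega>)) / real n - (\<integral>\<omega>. u (X \<omega>) \<partial>P)\<bar> \<partial>P)
    \<le> sqrt ((\<integral>\<omega>. (u (X \<omega>))\<^sup>2 \<partial>P) / real n)"
proof -
  interpret prob_space P by fact
  note [measurable] = X u
  define m where "m = (\<integral>\<omega>. u (X \<omega>) \<partial>P)"
  define v where "v = (\<lambda>z. u z - m)"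
  have v [measurable]: "v \<in> borel_measurable borel" by (simp add: v_def)
  have iu: "integrable P (\<lambda>\<omega>. u (X \<omega>))"
    using int by (rule abs_expectation_le_sqrt(1)[rotated]) simp
  have iv2: "integrable P (\<lambda>\<omega>. (v (X \<omega>))\<^sup>2)"
    using iu int by (auto simp: v_def power2_diff)
  \<comment> \<open>The centred second moment is a variance, hence at most the raw one. Raw moments
    are what the applications control.\<close>
  have ev2: "expectation (\<lambda>\<omega>. (v (X \<omega>))\<^sup>2) \<le> expectation (\<lambda>\<omega>. (u (X \<omega>))\<^sup>2)"
    using variance_eq[OF iu int] by (simp add: v_def m_def)
  have ev: "expectation (\<lambda>\<omega>. v (X \<omega>)) = 0"
    using iu by (simp add: v_def m_def prob_space)
  have v2: "(\<lambda>z. (v z)\<^sup>2) \<in> borel_measurable borel" by simp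
  note tr = iid_samples_transfer[OF iid _ P X]
  have ind: "indep_vars (\<lambda>_. borel) (\<lambda>i \<omega>. v (Z i \<omega>)) {..<n}"
    using iid v by (intro indep_vars_compose2[where M' = "\<lambda>_. borel" and Y = "\<lambda>_. v"])
      (simp_all add: iid_samples_def)
  have I: "integrable P (\<lambda>\<omega>. (\<Sum>i<n. v (Z i \<omega>))\<^sup>2)"
    and E: "expectation (\<lambda>\<omega>. (\<Sum>i<n. v (Z i \<omega>))\<^sup>2) = (\<Sum>i<n. expectation (\<lambda>\<omega>. (v (Z i \<omega>))\<^sup>2))"
    using expectation_sum_indep_centred_square[OF _ ind] tr(2,3)[OF _ v] tr(2,3)[OF _ v2] iv2 ev by simp_all
  have E': "expectation (\<lambda>\<omega>. (\<Sum>i<n. v (Z i \<omega>))\<^sup>2) \<le> real n * expectation (\<lambda>\<omega>. (u (X \<omega>))\<^sup>2)"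
    using E tr(3)[OF _ v2] ev2 by (simp add: mult_left_mono)
  have "expectation (\<lambda>\<omega>. \<bar>\<Sum>i<n. v (Z i \<omega>)\<bar>) \<le> sqrt (real n * expectation (\<lambda>\<omega>. (u (X \<omega>))\<^sup>2))"
  proof (rule order_trans[OF abs_expectation_le_sqrt(2)])
    show "(\<lambda>\<omega>. \<Sum>i<n. v (Z i \<omega>)) \<in> borel_measurable P"
      using tr(1)[OF _ v] by (intro borel_measurable_sum measurable_compose[OF _ v]) auto
  qed (use I E' in auto)
  moreover have "(\<Sum>i<n. u (Z i \<omega>)) / real n - m = (\<Sum>i<n. v (Z i \<omega>)) / real n" for \<omega>
    using n by (simp add: v_def sum_subtractf field_simps)
  ultimately have "(\<integral>\<omega>. \<bar>(\<Sum>i<n. u (Z i \<omega>)) / real n - m\<bar> \<partial>P)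
      \<le> sqrt (real n * expectation (\<lambda>\<omega>. (u (X \<omega>))\<^sup>2)) / real n"
    using n by (simp add: divide_right_mono)
  also have "\<dots> = sqrt ((\<integral>\<omega>. (u (X \<omega>))\<^sup>2 \<partial>P) / real n)"
    using n by (simp add: real_sqrt_mult real_sqrt_divide real_div_sqrt field_simps)
  finally show ?thesis unfolding m_def .
qed

section \<open>Truncation and sample means of a perturbed loss\<close>

lemma abs_le_mean_if_square_le_mult:
  fixes x a b :: real
  assumes "x\<^sup>2 \<le> a * b" "0 \<le> a" "0 \<le> b"
  shows "\<bar>x\<bar> \<le> (a + b) / 2"
proof -
  have "x\<^sup>2 \<le> ((a + b) / 2)\<^sup>2"
    using assms(1) zero_le_power2[of "a - b"] by (simp add: power2_eq_square field_simps)
  then show ?thesis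
    using assms(2,3) abs_le_square_iff[of x "(a + b) / 2"] by simp
qed

text \<open>A Markov-type argument: above the threshold, A is at most its square divided by
  \<open>s * v\<close>. The relative moment bound \<kappa> then keeps the result linear in
  \<open>v\<close>.\<close>

lemma expectation_above_threshold_le:
  fixes A :: "'a \<Rightarrow> real" and s \<kappa> :: real
  assumes P: "prob_space P" and A: "A \<in> borel_measurable P" "\<And>\<omega>. 0 \<le> A \<omega>"
    and A2: "integrable P (\<lambda>\<omega>. (A \<omega>)\<^sup>2)"
    and v: "v = (\<integral>\<omega>. A \<omega> \<partial>P)" and \<kappa>: "(\<integral>\<omega>. (A \<omega>)\<^sup>2 \<partial>P) \<le> \<kappa> * v\<^sup>2" and s: "s > 0"
  shows "(\<integral>\<omega>. (if A \<omega> \<le> s * v then 0 else A \<omega>) \<partial>P) \<le> \<kappa> * v / s"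
proof -
  interpret prob_space P by fact
  note [measurable] = A(1)
  have iA: "integrable P A" by (rule abs_expectation_le_sqrt(1)[OF A(1) A2])
  have iT: "integrable P (\<lambda>\<omega>. if A \<omega> \<le> s * v then 0 else A \<omega>)"
    by (rule Bochner_Integration.integrable_bound[OF iA]) auto
  have v0: "0 \<le> v" unfolding v using A by simp
  show ?thesis
  proof (cases "v = 0")
    case True
    have "(\<integral>\<omega>. (if A \<omega> \<le> s * v then 0 else A \<omega>) \<partial>P) \<le> (\<integral>\<omega>. A \<omega> \<partial>P)"
      using iT iA A by (intro integral_mono) auto
    then show ?thesis using True v by simp
  next
    case False
    then have pos: "0 < s * v" using v0 s by simp
    have "(\<integral>\<omega>. (if A \<omega> \<le> s * v then 0 else A \<omega>) \<partial>P) \<le> (\<integral>\<omega>. (A \<omega>)\<^sup>2 / (s * v) \<partial>P)"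
    proof (rule integral_mono[OF iT])
      fix \<omega>
      show "(if A \<omega> \<le> s * v then 0 else A \<omega>) \<le> (A \<omega>)\<^sup>2 / (s * v)"
        using pos A(2)[of \<omega>] by (auto simp: field_simps power2_eq_square intro!: mult_left_mono)
    qed (use A2 in simp)
    also have "\<dots> \<le> \<kappa> * v\<^sup>2 / (s * v)"
      using \<kappa> pos by (simp add: divide_right_mono)
    also have "\<dots> = \<kappa> * v / s" using False s by (simp add: power2_eq_square)
    finally show ?thesis .
  qed
qed

text \<open>The cross term \<open>X\<close> need not be square integrable, so its sample mean has no variance bound.
  Truncating at \<open>A \<le> sqrt n * v\<close> gives a second moment of at most \<open>sqrt n * v * \<delta>\<close>, and AM-GM
  turns the resulting deviation \<open>sqrt (v * \<delta> / sqrt n)\<close> into the sum of the two admissible error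
  terms \<open>v / sqrt n\<close> and \<open>\<delta>\<close>. The part above the threshold is bounded with the second moment of \<open>A\<close>.\<close>

lemma perturbed_sample_mean_deviation:
  fixes A X B :: "'z :: topological_space \<Rightarrow> real" and \<kappa> v \<delta> :: real
  assumes P: "prob_space P" and iid: "iid_samples P W Z n" and n: "n > 0"
    and W: "W \<in> borel_measurable P"
    and meas: "A \<in> borel_measurable borel" "X \<in> borel_measurable borel" "B \<in> borel_measurable borel"
    and nonneg: "\<And>z. 0 \<le> A z" "\<And>z. 0 \<le> B z" and cs: "\<And>z. (X z)\<^sup>2 \<le> A z * B z"
    and A2: "integrable P (\<lambda>\<omega>. (A (W \<omega>))\<^sup>2)" and iB: "integrable P (\<lambda>\<omega>. B (W \<omega>))"
    and v: "v = (\<integral>\<omega>. A (W \<omega>) \<partial>P)"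
    and \<kappa>: "(\<integral>\<omega>. (A (W \<omega>))\<^sup>2 \<partial>P) \<le> \<kappa> * v\<^sup>2" and \<kappa>1: "1 \<le> \<kappa>"
    and X0: "0 \<le> (\<integral>\<omega>. X (W \<omega>) \<partial>P)"
    and \<delta>: "\<delta> = (\<integral>\<omega>. A (W \<omega>) + 2 * X (W \<omega>) + B (W \<omega>) \<partial>P) - v"
  shows "integrable P (\<lambda>\<omega>. \<bar>(\<Sum>i<n. A (Z i \<omega>) + 2 * X (Z i \<omega>) + B (Z i \<omega>)) / real n - v\<bar>)"
    and "(\<integral>\<omega>. \<bar>(\<Sum>i<n. A (Z i \<omega>) + 2 * X (Z i \<omega>) + B (Z i \<omega>)) / real n - v\<bar> \<partial>P)
      \<le> 4 * \<kappa> * v / sqrt (real n) + 4 * \<delta>"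
proof -
  interpret prob_space P by fact
  note [measurable] = W meas
  define s where "s = sqrt (real n)"
  have s: "s > 0" "s * s = real n" using n by (auto simp: s_def)
  define U where "U = (\<lambda>z. if A z \<le> s * v then X z else 0)"
  define R where "R = (\<lambda>z. \<bar>X z - U z\<bar>)"
  have [measurable]: "U \<in> borel_measurable borel" "R \<in> borel_measurable borel"
    by (auto simp: U_def R_def)
  have iA: "integrable P (\<lambda>\<omega>. A (W \<omega>))"
    using A2 by (rule abs_expectation_le_sqrt(1)[rotated]) simp
  have Xle: "\<bar>X z\<bar> \<le> (A z + B z) / 2" for z
    using abs_le_mean_if_square_le_mult[OF cs nonneg] .
  have iX: "integrable P (\<lambda>\<omega>. X (W \<omega>))"
  proof (rule Bochner_Integration.integrable_bound)
    show "integrable P (\<lambda>\<omega>. (A (W \<omega>) + B (W \<omega>)) / 2)" using iA iB by simp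
  qed (use Xle nonneg in auto)
  have iU: "integrable P (\<lambda>\<omega>. U (W \<omega>))" and iR: "integrable P (\<lambda>\<omega>. R (W \<omega>))"
    by (rule Bochner_Integration.integrable_bound[OF iX]; auto simp: U_def R_def)+
  have v0: "0 \<le> v" unfolding v using nonneg by simp
  have B0: "0 \<le> (\<integral>\<omega>. B (W \<omega>) \<partial>P)" using nonneg by simp
  have \<delta>': "\<delta> = 2 * (\<integral>\<omega>. X (W \<omega>) \<partial>P) + (\<integral>\<omega>. B (W \<omega>) \<partial>P)"
    using iA iX iB by (simp add: \<delta> v)
  \<comment> \<open>The sign condition \<open>X0\<close> enters here: \<delta> is a sum of two
    nonnegative parts, so it dominates the mean of \<open>B\<close>.\<close>
  have B\<delta>: "(\<integral>\<omega>. B (W \<omega>) \<partial>P) \<le> \<delta>" and \<delta>0: "0 \<le> \<delta>" using \<delta>' X0 B0 by auto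
  have U2: "(U z)\<^sup>2 \<le> s * v * B z" for z
    using cs[of z] nonneg[of z] mult_right_mono[of "A z" "s * v" "B z"] s v0
    by (auto simp: U_def)
  have iU2: "integrable P (\<lambda>\<omega>. (U (W \<omega>))\<^sup>2)"
    by (rule Bochner_Integration.integrable_bound[of _ "\<lambda>\<omega>. s * v * B (W \<omega>)"])
      (use U2 nonneg iB s v0 in auto)
  have eU2: "(\<integral>\<omega>. (U (W \<omega>))\<^sup>2 \<partial>P) \<le> s * v * \<delta>"
  proof -
    have "(\<integral>\<omega>. (U (W \<omega>))\<^sup>2 \<partial>P) \<le> (\<integral>\<omega>. s * v * B (W \<omega>) \<partial>P)"
      using iU2 iB U2 by (intro integral_mono) auto
    also have "\<dots> \<le> s * v * \<delta>" using B\<delta> s v0 by (auto intro!: mult_left_mono)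
    finally show ?thesis .
  qed
  \<comment> \<open>\<open>R\<close> vanishes below the threshold. Above it, \<open>R\<close> equals
    \<open>\<bar>X\<bar>\<close>, which is at most half of \<open>A + B\<close>; hence only the tail
    of \<open>A\<close> and the mean of \<open>B\<close> remain.\<close>
  have eR: "(\<integral>\<omega>. R (W \<omega>) \<partial>P) \<le> (\<kappa> * v / s + \<delta>) / 2"
  proof -
    have iT: "integrable P (\<lambda>\<omega>. if A (W \<omega>) \<le> s * v then 0 else A (W \<omega>))"
      by (rule Bochner_Integration.integrable_bound[OF iA]) auto
    have "(\<integral>\<omega>. R (W \<omega>) \<partial>P) \<le> (\<integral>\<omega>. ((if A (W \<omega>) \<le> s * v then 0 else A (W \<omega>)) + B (W \<omega>)) / 2 \<partial>P)"
      using iR iT iB Xle nonneg by (intro integral_mono) (auto simp: R_def U_def)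
    also have "\<dots> = ((\<integral>\<omega>. (if A (W \<omega>) \<le> s * v then 0 else A (W \<omega>)) \<partial>P) + (\<integral>\<omega>. B (W \<omega>) \<partial>P)) / 2"
      using iT iB by simp
    also have "\<dots> \<le> (\<kappa> * v / s + \<delta>) / 2"
      using expectation_above_threshold_le[OF P _ _ A2 v \<kappa> s(1)] nonneg B\<delta>
      by (intro divide_right_mono add_mono) auto
    finally show ?thesis .
  qed
  define m where "m = (\<lambda>F \<omega>. (\<Sum>i<n. F (Z i \<omega>)) / real n)"
  note tr = iid_samples_transfer[OF iid _ P W]
  have m: "integrable P (m F)" "(\<integral>\<omega>. m F \<omega> \<partial>P) = (\<integral>\<omega>. F (W \<omega>) \<partial>P)"
    if "F \<in> borel_measurable borel" "integrable P (\<lambda>\<omega>. F (W \<omega>))" for F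
  proof -
    have "integrable P (\<lambda>\<omega>. \<Sum>i<n. F (Z i \<omega>))"
      using tr(2)[OF _ that(1)] that(2) by (intro Bochner_Integration.integrable_sum) simp
    then show "integrable P (m F)" unfolding m_def by simp
    have "(\<integral>\<omega>. m F \<omega> \<partial>P) = (\<Sum>i<n. \<integral>\<omega>. F (Z i \<omega>) \<partial>P) / real n"
      unfolding m_def using tr(2)[OF _ that(1)] that(2) by simp
    also have "\<dots> = (\<integral>\<omega>. F (W \<omega>) \<partial>P)" using tr(3)[OF _ that(1)] n by simp
    finally show "(\<integral>\<omega>. m F \<omega> \<partial>P) = (\<integral>\<omega>. F (W \<omega>) \<partial>P)" .
  qed
  define u where "u = (\<integral>\<omega>. U (W \<omega>) \<partial>P)"
  have mean: "(\<Sum>i<n. A (Z i \<omega>) + 2 * X (Z i \<omega>) + B (Z i \<omega>)) / real n = m A \<omega> + 2 * m X \<omega> + m B \<omega>" for \<omega>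
    by (simp add: m_def sum.distrib sum_distrib_left add_divide_distrib)
  note ints = m(1)[OF meas(1) iA] m(1)[OF meas(2) iX] m(1)[OF meas(3) iB]
    m(1)[OF _ iU] m(1)[OF _ iR]
  show int: "integrable P (\<lambda>\<omega>. \<bar>(\<Sum>i<n. A (Z i \<omega>) + 2 * X (Z i \<omega>) + B (Z i \<omega>)) / real n - v\<bar>)"
    unfolding mean using ints by simp
  \<comment> \<open>The mean of \<open>X\<close> is kept rather than estimated by \<delta>, because
    twice this mean plus the mean of \<open>B\<close> is exactly \<delta> in the final
    count.\<close>
  have uX: "\<bar>u\<bar> \<le> (\<integral>\<omega>. X (W \<omega>) \<partial>P) + (\<integral>\<omega>. R (W \<omega>) \<partial>P)"
  proof -
    have "u = (\<integral>\<omega>. X (W \<omega>) \<partial>P) - (\<integral>\<omega>. X (W \<omega>) - U (W \<omega>) \<partial>P)"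
      using iX iU by (simp add: u_def)
    moreover have "\<bar>\<integral>\<omega>. X (W \<omega>) - U (W \<omega>) \<partial>P\<bar> \<le> (\<integral>\<omega>. R (W \<omega>) \<partial>P)"
      unfolding R_def by (rule integral_abs_bound)
    ultimately show ?thesis using X0 by linarith
  qed
  \<comment> \<open>Of the cross term, only the truncated part is compared with its mean; the
    remainder is absorbed by \<open>m R\<close>. The nonnegative \<open>m B\<close> is left
    uncentred.\<close>
  have pw: "\<bar>m A \<omega> + 2 * m X \<omega> + m B \<omega> - v\<bar>
      \<le> \<bar>m A \<omega> - v\<bar> + 2 * \<bar>m U \<omega> - u\<bar> + 2 * m R \<omega> + 2 * \<bar>u\<bar> + m B \<omega>" for \<omega>
  proof -
    have "m X \<omega> - m U \<omega> = (\<Sum>i<n. X (Z i \<omega>) - U (Z i \<omega>)) / real n"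
      by (simp add: m_def sum_subtractf diff_divide_distrib)
    then have "\<bar>m X \<omega> - m U \<omega>\<bar> \<le> m R \<omega>"
      by (auto simp: m_def R_def intro!: divide_right_mono sum_abs)
    moreover have "0 \<le> m B \<omega>" using nonneg by (auto simp: m_def intro!: divide_nonneg_nonneg sum_nonneg)
    moreover have "\<bar>m X \<omega>\<bar> \<le> \<bar>m U \<omega> - u\<bar> + \<bar>m X \<omega> - m U \<omega>\<bar> + \<bar>u\<bar>" by linarith
    moreover have "\<bar>m A \<omega> + 2 * m X \<omega> + m B \<omega> - v\<bar> \<le> \<bar>m A \<omega> - v\<bar> + 2 * \<bar>m X \<omega>\<bar> + \<bar>m B \<omega>\<bar>"
      by linarith
    ultimately show ?thesis by simp
  qed
  have dA: "(\<integral>\<omega>. \<bar>m A \<omega> - v\<bar> \<partial>P) \<le> \<kappa> * v / s"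
  proof -
    have "(\<integral>\<omega>. \<bar>m A \<omega> - v\<bar> \<partial>P) \<le> sqrt ((\<integral>\<omega>. (A (W \<omega>))\<^sup>2 \<partial>P) / real n)"
      using iid_sample_mean_deviation[OF P iid n W meas(1) A2] by (simp add: m_def v)
    also have "\<dots> \<le> sqrt ((\<kappa> * v / s)\<^sup>2)"
    proof (rule real_sqrt_le_mono)
      \<comment> \<open>Since \<open>1 \<le> \<kappa>\<close>, the factor may be squared; the root
        then yields \<kappa> itself, in line with the other terms.\<close>
      have "\<kappa> * v\<^sup>2 \<le> (\<kappa> * v)\<^sup>2"
        using \<kappa>1 mult_right_mono[of \<kappa> "\<kappa>\<^sup>2" "v\<^sup>2"] self_le_power[of \<kappa> 2]
        by (simp add: power_mult_distrib)
      then have "(\<integral>\<omega>. (A (W \<omega>))\<^sup>2 \<partial>P) / real n \<le> (\<kappa> * v)\<^sup>2 / real n"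
        using \<kappa> by (intro divide_right_mono) auto
      then show "(\<integral>\<omega>. (A (W \<omega>))\<^sup>2 \<partial>P) / real n \<le> (\<kappa> * v / s)\<^sup>2"
        using s by (simp add: power_divide power2_eq_square)
    qed
    also have "\<dots> = \<kappa> * v / s" using \<kappa>1 v0 s by simp
    finally show ?thesis .
  qed
  have dU: "2 * (\<integral>\<omega>. \<bar>m U \<omega> - u\<bar> \<partial>P) \<le> v / s + \<delta>"
  proof -
    have "(\<integral>\<omega>. \<bar>m U \<omega> - u\<bar> \<partial>P) \<le> sqrt ((\<integral>\<omega>. (U (W \<omega>))\<^sup>2 \<partial>P) / real n)"
      using iid_sample_mean_deviation[OF P iid n W _ iU2] by (simp add: m_def u_def)
    also have "\<dots> \<le> sqrt (s * v * \<delta> / real n)"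
      using eU2 by (intro real_sqrt_le_mono divide_right_mono) auto
    also have "s * v * \<delta> / real n = v / s * \<delta>" using s by (simp flip: s(2))
    also have "sqrt (v / s * \<delta>) \<le> (v / s + \<delta>) / 2"
      using v0 s \<delta>0 by (intro arith_geo_mean_sqrt) auto
    finally show ?thesis by simp
  qed
  have "(\<integral>\<omega>. \<bar>m A \<omega> + 2 * m X \<omega> + m B \<omega> - v\<bar> \<partial>P)
      \<le> (\<integral>\<omega>. \<bar>m A \<omega> - v\<bar> + 2 * \<bar>m U \<omega> - u\<bar> + 2 * m R \<omega> + 2 * \<bar>u\<bar> + m B \<omega> \<partial>P)"
    using ints pw by (intro integral_mono) auto
  also have "\<dots> = (\<integral>\<omega>. \<bar>m A \<omega> - v\<bar> \<partial>P) + 2 * (\<integral>\<omega>. \<bar>m U \<omega> - u\<bar> \<partial>P)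
      + 2 * (\<integral>\<omega>. R (W \<omega>) \<partial>P) + 2 * \<bar>u\<bar> + (\<integral>\<omega>. B (W \<omega>) \<partial>P)"
    using ints m(2)[OF meas(3) iB] m(2)[OF _ iR] by (simp add: prob_space)
  \<comment> \<open>One \<open>\<kappa> * v / s\<close> comes from \<open>dA\<close> and two from
    the means of \<open>R\<close>, one of them hidden in \<open>uX\<close>; \<open>v / s\<close>
    comes from \<open>dU\<close>. One \<delta> comes from \<open>dU\<close>, two from
    \<open>R\<close>, and the last from the means of \<open>X\<close> and \<open>B\<close>
    together.\<close>
  also have "\<dots> \<le> 3 * (\<kappa> * v / s) + v / s + 4 * \<delta>"
    using dA dU eR uX \<delta>' by argo
  also have "\<dots> \<le> 4 * \<kappa> * v / s + 4 * \<delta>"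
  proof -
    have "v / s \<le> \<kappa> * v / s"
      using \<kappa>1 v0 s by (intro divide_right_mono mult_right_mono[of 1 \<kappa> v, simplified]) auto
    then show ?thesis by simp
  qed
  finally show "(\<integral>\<omega>. \<bar>(\<Sum>i<n. A (Z i \<omega>) + 2 * X (Z i \<omega>) + B (Z i \<omega>)) / real n - v\<bar> \<partial>P)
      \<le> 4 * \<kappa> * v / sqrt (real n) + 4 * \<delta>"
    unfolding mean s_def .
qed

section \<open>Quadratic loss and optimality over a convex set of maps\<close>

lemma power2_norm_diff_via:
  fixes q a b :: "'v :: real_inner"
  shows "(norm (q - b))\<^sup>2 = (norm (q - a))\<^sup>2 + 2 * inner (q - a) (a - b) + (norm (a - b))\<^sup>2"
proof -
  have "q - b = (q - a) + (a - b)" by simp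
  then show ?thesis
    by (simp only: power2_norm_eq_inner inner_add_left inner_add_right)
      (simp add: inner_commute)
qed

lemma integrable_power2_norm_diff:
  fixes F G :: "'a \<Rightarrow> 'v :: euclidean_space"
  assumes "finite_variance P F" "finite_variance P G"
  shows "integrable P (\<lambda>\<omega>. (norm (F \<omega> - G \<omega>))\<^sup>2)"
proof (rule Bochner_Integration.integrable_bound)
  have [measurable]: "F \<in> borel_measurable P" "G \<in> borel_measurable P"
    using assms by (auto simp: finite_variance_def)
  show "integrable P (\<lambda>\<omega>. 2 * (norm (F \<omega>))\<^sup>2 + 2 * (norm (G \<omega>))\<^sup>2)"
    using assms by (simp add: finite_variance_def)
  show "(\<lambda>\<omega>. (norm (F \<omega> - G \<omega>))\<^sup>2) \<in> borel_measurable P" by simp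
  have "(norm (x - y))\<^sup>2 \<le> 2 * (norm x)\<^sup>2 + 2 * (norm y)\<^sup>2" for x y :: 'v
  proof -
    have "(norm (x - y))\<^sup>2 \<le> (norm x + norm y)\<^sup>2"
      by (intro power_mono norm_triangle_ineq4) auto
    also have "\<dots> \<le> 2 * (norm x)\<^sup>2 + 2 * (norm y)\<^sup>2"
      using zero_le_power2[of "norm x - norm y"] by (simp add: power2_eq_square algebra_simps)
    finally show ?thesis .
  qed
  then show "AE \<omega> in P. norm ((norm (F \<omega> - G \<omega>))\<^sup>2) \<le> norm (2 * (norm (F \<omega>))\<^sup>2 + 2 * (norm (G \<omega>))\<^sup>2)"
    by simp
qed

text \<open>Along the segment from \<open>f\<close> to \<open>g\<close> the error is quadratic in
  the position, and its linear coefficient is twice this integral. A negative coefficient would let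
  a short move improve on the minimizer.\<close>

lemma first_order_optimality:
  fixes S :: "(real ^ 'm \<Rightarrow> real ^ 'n) set"
  assumes Q: "finite_variance P Q"
    and S: "S \<subseteq> finite_variance_maps P Y" "convex_function_set S"
    and min: "is_arg_min (mse P Q Y) (\<lambda>g. g \<in> S) f" and g: "g \<in> S"
  shows "0 \<le> (\<integral>\<omega>. inner (Q \<omega> - f (Y \<omega>)) (f (Y \<omega>) - g (Y \<omega>)) \<partial>P)" (is "0 \<le> ?I")
proof (rule ccontr)
  assume "\<not> 0 \<le> ?I"
  then have neg: "?I < 0" by simp
  let ?a = "\<lambda>\<omega>. Q \<omega> - f (Y \<omega>)" and ?b = "\<lambda>\<omega>. f (Y \<omega>) - g (Y \<omega>)"
  have f: "f \<in> S" using min by (simp add: is_arg_min_def)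
  have fv: "finite_variance P (\<lambda>\<omega>. f (Y \<omega>))" "finite_variance P (\<lambda>\<omega>. g (Y \<omega>))"
    using f g S by (auto simp: finite_variance_maps_def)
  have ia: "integrable P (\<lambda>\<omega>. (norm (?a \<omega>))\<^sup>2)" and ib: "integrable P (\<lambda>\<omega>. (norm (?b \<omega>))\<^sup>2)"
    using integrable_power2_norm_diff Q fv by blast+
  \<comment> \<open>A non-integrable function has integral 0 by convention, so a negative integral
    already forces integrability.\<close>
  have iab: "integrable P (\<lambda>\<omega>. inner (?a \<omega>) (?b \<omega>))"
    using neg not_integrable_integral_eq by force
  let ?B = "\<integral>\<omega>. (norm (?b \<omega>))\<^sup>2 \<partial>P"
  have B0: "0 \<le> ?B" by simp
  \<comment> \<open>The summand 1 keeps the denominator positive when \<open>?B\<close> is 0. This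
    choice gives \<open>t * ?B \<le> - ?I\<close>, so the increment
    \<open>t * (2 * ?I + t * ?B)\<close> is at most \<open>t * ?I\<close>, which is
    negative.\<close>
  define t where "t = min 1 (- ?I / (?B + 1))"
  have t: "0 < t" "t \<le> 1" "t \<le> - ?I / (?B + 1)"
    using neg divide_pos_pos[of "- ?I" "?B + 1"] B0 by (auto simp: t_def)
  define h where "h = (\<lambda>y. (1 - t) *\<^sub>R f y + t *\<^sub>R g y)"
  have "h \<in> S" using S(2) f g t unfolding convex_function_set_def h_def by auto
  then have le: "mse P Q Y f \<le> mse P Q Y h" using min by (auto simp: is_arg_min_def not_less)
  have "(norm (Q \<omega> - h (Y \<omega>)))\<^sup>2 = (norm (?a \<omega>))\<^sup>2 + 2 * t * inner (?a \<omega>) (?b \<omega>) + t\<^sup>2 * (norm (?b \<omega>))\<^sup>2" for \<omega>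
  proof -
    have "f (Y \<omega>) - h (Y \<omega>) = t *\<^sub>R ?b \<omega>" by (simp add: h_def algebra_simps)
    then show ?thesis
      using power2_norm_diff_via[of "Q \<omega>" "h (Y \<omega>)" "f (Y \<omega>)"] by (simp add: power_mult_distrib)
  qed
  then have "mse P Q Y h = mse P Q Y f + 2 * t * ?I + t\<^sup>2 * ?B"
    using ia iab ib by (simp add: mse_def)
  with le have "0 \<le> t * (2 * ?I + t * ?B)" by (simp add: algebra_simps power2_eq_square)
  then have "0 \<le> 2 * ?I + t * ?B" using t by (simp add: zero_le_mult_iff)
  moreover have "t * ?B \<le> - ?I"
  proof -
    have "t * ?B \<le> t * (?B + 1)" using t by simp
    also have "\<dots> \<le> - ?I" using t(3) B0 by (simp add: field_simps)
    finally show ?thesis .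
  qed
  ultimately show False using neg by linarith
qed

section \<open>Empirical error of a fixed map\<close>

lemma mse_hat_map:
  "mse_hat g (map z [0..<n]) = (\<Sum>i<n. (norm (fst (z i) - g (snd (z i))))\<^sup>2) / real n"
  by (simp add: mse_hat_def comp_def case_prod_beta interv_sum_list_conv_sum_set_nat atLeast0LessThan)

lemma map_restrict_upt: "map (\<lambda>i\<in>{..<n}. Z i \<omega>) [0..<n] = dataset Z n \<omega>"
  by (simp add: dataset_def)

lemma borel_measurable_fst_snd [measurable]:
  "fst \<in> (borel :: ('y :: second_countable_topology \<times> 'z :: second_countable_topology) measure) \<rightarrow>\<^sub>M borel"
  "snd \<in> (borel :: ('y :: second_countable_topology \<times> 'z :: second_countable_topology) measure) \<rightarrow>\<^sub>M borel"
  by (simp_all add: borel_prod[symmetric])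

text \<open>The perturbed mean is applied with \<open>A\<close> the loss of \<open>f\<close>,
  \<open>B\<close> the squared distance of \<open>f\<close> and \<open>g\<close>, and
  \<open>X\<close> the cross term. Cauchy-Schwarz relates the three, and first-order optimality
  gives the sign of the mean of \<open>X\<close>.\<close>

lemma mse_hat_mean_deviation:
  fixes S :: "(real ^ 'm \<Rightarrow> real ^ 'n) set"
  assumes P: "prob_space P" and Q: "finite_variance P Q" and Y: "Y \<in> borel_measurable P"
    and S: "S \<subseteq> finite_variance_maps P Y" "convex_function_set S"
    and min: "is_arg_min (mse P Q Y) (\<lambda>g. g \<in> S) f" and g: "g \<in> S"
    and sq: "integrable P (\<lambda>\<omega>. ((norm (Q \<omega> - f (Y \<omega>)))\<^sup>2)\<^sup>2)"
    and \<kappa>: "(\<integral>\<omega>. ((norm (Q \<omega> - f (Y \<omega>)))\<^sup>2)\<^sup>2 \<partial>P) \<le> \<kappa> * (mse P Q Y f)\<^sup>2" "1 \<le> \<kappa>"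
    and iid: "iid_samples P (\<lambda>\<omega>. (Q \<omega>, Y \<omega>)) Z n" and n: "n > 0"
  shows "integrable P (\<lambda>\<omega>. \<bar>mse_hat g (dataset Z n \<omega>) - mse P Q Y f\<bar>)"
    and "(\<integral>\<omega>. \<bar>mse_hat g (dataset Z n \<omega>) - mse P Q Y f\<bar> \<partial>P)
      \<le> 4 * \<kappa> * mse P Q Y f / sqrt (real n) + 4 * (mse P Q Y g - mse P Q Y f)"
proof -
  have f: "f \<in> S" using min by (simp add: is_arg_min_def)
  have fv: "finite_variance P (\<lambda>\<omega>. f (Y \<omega>))" "finite_variance P (\<lambda>\<omega>. g (Y \<omega>))"
    and [measurable]: "f \<in> borel_measurable borel" "g \<in> borel_measurable borel"
    using f g S by (auto simp: finite_variance_maps_def)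
  note [measurable] = Y
  have [measurable]: "Q \<in> borel_measurable P" using Q by (simp add: finite_variance_def)
  define A X B where "A = (\<lambda>z. (norm (fst z - f (snd z)))\<^sup>2)"
    and "X = (\<lambda>z. inner (fst z - f (snd z)) (f (snd z) - g (snd z)))"
    and "B = (\<lambda>z :: (real ^ 'n) \<times> (real ^ 'm). (norm (f (snd z) - g (snd z)))\<^sup>2)"
  note defs = A_def X_def B_def
  have decomp: "(norm (fst z - g (snd z)))\<^sup>2 = A z + 2 * X z + B z" for z
    unfolding defs by (rule power2_norm_diff_via)
  have cs: "(X z)\<^sup>2 \<le> A z * B z" for z
    unfolding defs using Cauchy_Schwarz_ineq by (simp add: power2_norm_eq_inner)
  have W: "(\<lambda>\<omega>. (Q \<omega>, Y \<omega>)) \<in> borel_measurable P" by simp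
  have M: "A \<in> borel_measurable borel" "X \<in> borel_measurable borel" "B \<in> borel_measurable borel"
    unfolding defs by measurable
  have iB: "integrable P (\<lambda>\<omega>. B (Q \<omega>, Y \<omega>))"
    using integrable_power2_norm_diff[OF fv] by (simp add: B_def)
  have v: "mse P Q Y f = (\<integral>\<omega>. A (Q \<omega>, Y \<omega>) \<partial>P)" by (simp add: A_def mse_def)
  have X0: "0 \<le> (\<integral>\<omega>. X (Q \<omega>, Y \<omega>) \<partial>P)"
    using first_order_optimality[OF Q S min g] by (simp add: X_def)
  have \<delta>: "mse P Q Y g - mse P Q Y f
      = (\<integral>\<omega>. A (Q \<omega>, Y \<omega>) + 2 * X (Q \<omega>, Y \<omega>) + B (Q \<omega>, Y \<omega>) \<partial>P) - mse P Q Y f"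
    unfolding decomp[symmetric] by (simp add: mse_def)
  have sq': "integrable P (\<lambda>\<omega>. (A (Q \<omega>, Y \<omega>))\<^sup>2)"
    "(\<integral>\<omega>. (A (Q \<omega>, Y \<omega>))\<^sup>2 \<partial>P) \<le> \<kappa> * (mse P Q Y f)\<^sup>2"
    using sq \<kappa> by (simp_all add: A_def)
  have nonneg: "0 \<le> A z" "0 \<le> B z" for z by (simp_all add: defs)
  have eq: "mse_hat g (dataset Z n \<omega>) = (\<Sum>i<n. A (Z i \<omega>) + 2 * X (Z i \<omega>) + B (Z i \<omega>)) / real n" for \<omega>
    by (simp add: dataset_def mse_hat_map decomp)
  note dev = perturbed_sample_mean_deviation[OF P iid n W M nonneg cs sq'(1) iB v sq'(2) \<kappa>(2) X0 \<delta>]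
  show "integrable P (\<lambda>\<omega>. \<bar>mse_hat g (dataset Z n \<omega>) - mse P Q Y f\<bar>)"
    unfolding eq by (rule dev(1))
  show "(\<integral>\<omega>. \<bar>mse_hat g (dataset Z n \<omega>) - mse P Q Y f\<bar> \<partial>P)
      \<le> 4 * \<kappa> * mse P Q Y f / sqrt (real n) + 4 * (mse P Q Y g - mse P Q Y f)"
    unfolding eq by (rule dev(2))
qed

section \<open>Averaging over the training data\<close>

text \<open>Independence makes the joint law a product, so bounds for each frozen \<open>x\<close>
  integrate over the law of \<open>X\<close>. Nonnegative integrals are used first because joint
  integrability is itself a conclusion.\<close>

lemma indep_var_expectation_le:
  fixes F :: "'x \<times> 'x \<Rightarrow> real" and G :: "'x \<Rightarrow> real"
  assumes P: "prob_space P" and ind: "prob_space.indep_var P S X T W"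
    and F: "F \<in> borel_measurable (S \<Otimes>\<^sub>M T)" and G: "G \<in> borel_measurable S"
    and iG: "integrable P (\<lambda>\<omega>. G (X \<omega>))"
    and iF: "\<And>x. x \<in> space S \<Longrightarrow> integrable P (\<lambda>\<omega>. \<bar>F (x, W \<omega>)\<bar>)"
    and le: "\<And>x. x \<in> space S \<Longrightarrow> (\<integral>\<omega>. \<bar>F (x, W \<omega>)\<bar> \<partial>P) \<le> G x"
  shows "integrable P (\<lambda>\<omega>. F (X \<omega>, W \<omega>))"
    and "(\<integral>\<omega>. \<bar>F (X \<omega>, W \<omega>)\<bar> \<partial>P) \<le> (\<integral>\<omega>. G (X \<omega>) \<partial>P)"
proof -
  interpret prob_space P by fact
  note [measurable] = F G
  have rv [measurable]: "random_variable S X" "random_variable T W"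
    and prod: "distr P S X \<Otimes>\<^sub>M distr P T W = distr P (S \<Otimes>\<^sub>M T) (\<lambda>\<omega>. (X \<omega>, W \<omega>))"
    using ind by (auto simp: indep_var_distribution_eq)
  interpret W: prob_space "distr P T W" by (rule prob_space_distr) fact
  have G0: "0 \<le> G x" if "x \<in> space S" for x
    using le[OF that] by (rule order_trans[rotated]) simp
  have "(\<integral>\<^sup>+\<omega>. ennreal \<bar>F (X \<omega>, W \<omega>)\<bar> \<partial>P) = (\<integral>\<^sup>+p. ennreal \<bar>F p\<bar> \<partial>(distr P S X \<Otimes>\<^sub>M distr P T W))"
    unfolding prod by (subst nn_integral_distr) auto
  also have "\<dots> = (\<integral>\<^sup>+x. \<integral>\<^sup>+w. ennreal \<bar>F (x, w)\<bar> \<partial>distr P T W \<partial>distr P S X)"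
    by (subst W.nn_integral_fst[symmetric]) auto
  also have "\<dots> \<le> (\<integral>\<^sup>+x. ennreal (G x) \<partial>distr P S X)"
  proof (rule nn_integral_mono)
    fix x assume "x \<in> space (distr P S X)"
    then have x: "x \<in> space S" by simp
    have "(\<integral>\<^sup>+w. ennreal \<bar>F (x, w)\<bar> \<partial>distr P T W) = (\<integral>\<^sup>+\<omega>. ennreal \<bar>F (x, W \<omega>)\<bar> \<partial>P)"
      using x by (subst nn_integral_distr) auto
    also have "\<dots> = ennreal (\<integral>\<omega>. \<bar>F (x, W \<omega>)\<bar> \<partial>P)"
      using iF[OF x] by (intro nn_integral_eq_integral) auto
    also have "\<dots> \<le> ennreal (G x)" using le[OF x] by (rule ennreal_leI)
    finally show "(\<integral>\<^sup>+w. ennreal \<bar>F (x, w)\<bar> \<partial>distr P T W) \<le> ennreal (G x)" .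
  qed
  also have "\<dots> = (\<integral>\<^sup>+\<omega>. ennreal (G (X \<omega>)) \<partial>P)"
    by (subst nn_integral_distr) auto
  also have "\<dots> = ennreal (\<integral>\<omega>. G (X \<omega>) \<partial>P)"
    using iG G0 measurable_space[OF rv(1)] by (intro nn_integral_eq_integral) auto
  finally have bound: "(\<integral>\<^sup>+\<omega>. ennreal \<bar>F (X \<omega>, W \<omega>)\<bar> \<partial>P) \<le> ennreal (\<integral>\<omega>. G (X \<omega>) \<partial>P)" .
  show int: "integrable P (\<lambda>\<omega>. F (X \<omega>, W \<omega>))"
    using bound by (intro integrableI_bounded) (auto intro: le_less_trans)
  have "0 \<le> (\<integral>\<omega>. G (X \<omega>) \<partial>P)"
    using G0 measurable_space[OF rv(1)] by (intro Bochner_Integration.integral_nonneg_AE) auto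
  moreover have "ennreal (\<integral>\<omega>. \<bar>F (X \<omega>, W \<omega>)\<bar> \<partial>P) \<le> ennreal (\<integral>\<omega>. G (X \<omega>) \<partial>P)"
    using bound nn_integral_eq_integral[of P "\<lambda>\<omega>. \<bar>F (X \<omega>, W \<omega>)\<bar>"] int by simp
  ultimately show "(\<integral>\<omega>. \<bar>F (X \<omega>, W \<omega>)\<bar> \<partial>P) \<le> (\<integral>\<omega>. G (X \<omega>) \<partial>P)"
    by simp
qed

text \<open>The integrands agree almost everywhere; what needs care is measurability of the
  conditional expectation, which is checked by coordinates.\<close>

lemma total_cond_variance_eq_mse:
  assumes "finite_variance P Q" and Y: "Y \<in> borel_measurable P" and \<phi>: "\<phi> \<in> borel_measurable borel"
    and eq: "AE \<omega> in P. \<phi> (Y \<omega>) = cond_exp_given P Q Y \<omega>"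
  shows "total_cond_variance P Q Y = mse P Q Y \<phi>"
  unfolding total_cond_variance_def mse_def
proof (rule integral_cong_AE)
  note [measurable] = Y \<phi>
  have [measurable]: "Q \<in> borel_measurable P" using assms(1) by (simp add: finite_variance_def)
  have "cond_exp_given P Q Y \<in> borel_measurable P"
  proof (rule borel_measurable_euclidean_space[THEN iffD2], rule ballI)
    fix i :: "real ^ 'b" assume "i \<in> Basis"
    then obtain k where "i = axis k 1" by (auto simp: Basis_vec_def)
    then show "(\<lambda>\<omega>. inner (cond_exp_given P Q Y \<omega>) i) \<in> borel_measurable P"
      by (simp add: cond_exp_given_def inner_axis)
  qed
  then show "(\<lambda>\<omega>. (norm (Q \<omega> - cond_exp_given P Q Y \<omega>))\<^sup>2) \<in> borel_measurable P" by simp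
  show "(\<lambda>\<omega>. (norm (Q \<omega> - \<phi> (Y \<omega>)))\<^sup>2) \<in> borel_measurable P" by simp
  show "AE \<omega> in P. (norm (Q \<omega> - cond_exp_given P Q Y \<omega>))\<^sup>2 = (norm (Q \<omega> - \<phi> (Y \<omega>)))\<^sup>2"
    using eq by eventually_elim simp
qed

section \<open>Assembly of the error bound from the training and test contributions\<close>

theorem proposition2:
  fixes P :: "'a measure"
    and Q :: "'a \<Rightarrow> real ^ 'n"
    and Y \<Xi> :: "'a \<Rightarrow> real ^ 'm"
    and h :: "real ^ 'n \<Rightarrow> real ^ 'd \<Rightarrow> real ^ 'm"
    and d :: "real ^ 'd"
    and f :: "real ^ 'b \<Rightarrow> real ^ 'm \<Rightarrow> real ^ 'n"
    and \<theta>star :: "real ^ 'b"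
    and \<phi> :: "real ^ 'm \<Rightarrow> real ^ 'n"
    and train test :: "nat \<Rightarrow> nat \<Rightarrow> 'a \<Rightarrow> (real ^ 'n) \<times> (real ^ 'm)"
    and \<theta>hat :: "((real ^ 'n) \<times> (real ^ 'm)) list \<Rightarrow> real ^ 'b"
  assumes prob: "prob_space P"
    and obs_map: "(\<lambda>q. h q d) \<in> borel_measurable borel"
    and obs_error: "\<Xi> \<in> borel_measurable P"
    and obs: "\<And>\<omega>. \<omega> \<in> space P \<Longrightarrow> Y \<omega> = h (Q \<omega>) d + \<Xi> \<omega>"
    and fin_var_Q: "finite_variance P Q"
    and fin_var_Y: "finite_variance P Y"
    and phi_meas: "\<phi> \<in> borel_measurable borel"
    and phi: "AE \<omega> in P. \<phi> (Y \<omega>) = cond_exp_given P Q Y \<omega>"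
    and f_meas: "(\<lambda>(\<theta>, y). f \<theta> y) \<in> borel_measurable (borel \<Otimes>\<^sub>M borel)"
    and f_sub: "range f \<subseteq> finite_variance_maps P Y"
    and f_star: "is_arg_min (mse P Q Y) (\<lambda>g. g \<in> range f) (f \<theta>star)"
    and train: "\<And>N. iid_samples P (\<lambda>\<omega>. (Q \<omega>, Y \<omega>)) (train N) N"
    and test: "\<And>M. iid_samples P (\<lambda>\<omega>. (Q \<omega>, Y \<omega>)) (test M) M"
    and indep: "\<And>N M. indep_datasets P (train N) N (test M) M"
    and theta_meas:
      "\<And>N. (\<lambda>z. \<theta>hat (map z [0..<N])) \<in> borel_measurable (\<Pi>\<^sub>M i\<in>{..<N}. borel)"
    and theta_min: "\<And>N. AE \<omega> in P.
      is_arg_min (\<lambda>\<theta>. mse_hat (f \<theta>) (dataset (train N) N \<omega>)) (\<lambda>_. True)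
        (\<theta>hat (dataset (train N) N \<omega>))"
    and S'_convex: "convex_function_set (range f)"
    and S'_const: "\<And>c. (\<lambda>_. c) \<in> range f"
    and loss_fin_var: "finite_variance P (\<lambda>\<omega>. (norm (Q \<omega> - f \<theta>star (Y \<omega>)))\<^sup>2)"
    and loss_var: "\<exists>C. prob_space.variance P (\<lambda>\<omega>. (norm (Q \<omega> - f \<theta>star (Y \<omega>)))\<^sup>2)
        \<le> C * (2 * (mse P Q Y (f \<theta>star))\<^sup>2)"
    and opt_integrable: "\<forall>\<^sub>F N in sequentially. integrable P
      (\<lambda>\<omega>. \<bar>mse P Q Y (f (\<theta>hat (dataset (train N) N \<omega>))) - mse P Q Y (f \<theta>star)\<bar>)"
    and opt: "(\<lambda>N. \<integral>\<omega>. \<bar>mse P Q Y (f (\<theta>hat (dataset (train N) N \<omega>)))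
                        - mse P Q Y (f \<theta>star)\<bar> \<partial>P)
      \<in> O[sequentially](\<lambda>N. \<integral>\<omega>. \<bar>mse_hat (f \<theta>star) (dataset (train N) N \<omega>)
                        - mse P Q Y (f \<theta>star)\<bar> \<partial>P)"
  shows "(\<forall>\<^sub>F (N, M) in sequentially \<times>\<^sub>F sequentially. integrable P
      (\<lambda>\<omega>. \<bar>mse_hat (f (\<theta>hat (dataset (train N) N \<omega>))) (dataset (test M) M \<omega>)
            - total_cond_variance P Q Y\<bar>))
    \<and> (\<lambda>(N, M). (\<integral>\<omega>. \<bar>mse_hat (f (\<theta>hat (dataset (train N) N \<omega>))) (dataset (test M) M \<omega>)
                        - total_cond_variance P Q Y\<bar> \<partial>P)
              - \<bar>mse P Q Y (f \<theta>star) - mse P Q Y \<phi>\<bar>)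
      \<in> O[sequentially \<times>\<^sub>F sequentially](\<lambda>(N, M).
          (2 / sqrt (pi * real N) + 2 / sqrt (pi * real M)) * mse P Q Y (f \<theta>star))"
proof -
  interpret prob_space P by fact
  have Q [measurable]: "Q \<in> borel_measurable P" and Y [measurable]: "Y \<in> borel_measurable P"
    using fin_var_Q fin_var_Y by (simp_all add: finite_variance_def)
  note [measurable] = f_meas
  define v where "v = mse P Q Y (f \<theta>star)"
  define V where "V = mse P Q Y \<phi>"
  define \<epsilon> where "\<epsilon> = (\<lambda>N. \<integral>\<omega>. \<bar>mse P Q Y (f (\<theta>hat (dataset (train N) N \<omega>))) - v\<bar> \<partial>P)"
  define Vhat where
    "Vhat = (\<lambda>N M \<omega>. mse_hat (f (\<theta>hat (dataset (train N) N \<omega>))) (dataset (test M) M \<omega>))"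
  have V: "total_cond_variance P Q Y = V"
    unfolding V_def by (rule total_cond_variance_eq_mse[OF fin_var_Q Y phi_meas phi])
  have v0: "0 \<le> v" by (simp add: v_def mse_def)
  let ?A = "\<lambda>\<omega>. (norm (Q \<omega> - f \<theta>star (Y \<omega>)))\<^sup>2"
  have A2: "integrable P (\<lambda>\<omega>. (?A \<omega>)\<^sup>2)" and Am: "?A \<in> borel_measurable P"
    using loss_fin_var by (simp_all add: finite_variance_def)
  obtain C where C: "variance ?A \<le> C * (2 * v\<^sup>2)" using loss_var by (auto simp: v_def)
  \<comment> \<open>The raw second moment is the variance plus the square of \<open>v\<close>, so
    \<open>2 * C + 1\<close> suffices; the maximum secures \<open>1 \<le> \<kappa>\<close> whatever
    the sign of \<open>C\<close>.\<close>
  define \<kappa> where "\<kappa> = max 1 (2 * C + 1)"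
  have \<kappa>: "expectation (\<lambda>\<omega>. (?A \<omega>)\<^sup>2) \<le> \<kappa> * (mse P Q Y (f \<theta>star))\<^sup>2" "1 \<le> \<kappa>"
  proof -
    have "expectation (\<lambda>\<omega>. (?A \<omega>)\<^sup>2) = variance ?A + v\<^sup>2"
      using variance_eq[OF abs_expectation_le_sqrt(1)[OF Am A2] A2] by (simp add: v_def mse_def)
    also have "\<dots> \<le> (2 * C + 1) * v\<^sup>2" using C by (simp add: algebra_simps)
    also have "\<dots> \<le> \<kappa> * v\<^sup>2" by (intro mult_right_mono) (auto simp: \<kappa>_def)
    finally show "expectation (\<lambda>\<omega>. (?A \<omega>)\<^sup>2) \<le> \<kappa> * (mse P Q Y (f \<theta>star))\<^sup>2" by (simp add: v_def)
  qed (simp add: \<kappa>_def)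
  note dev = mse_hat_mean_deviation[OF prob fin_var_Q Y f_sub S'_convex f_star _ A2 \<kappa>]
  have mse_ge: "v \<le> mse P Q Y (f \<theta>)" for \<theta>
    using f_star by (auto simp: is_arg_min_def v_def not_less)
  have mse_meas: "(\<lambda>\<theta>. mse P Q Y (f \<theta>)) \<in> borel_measurable borel"
    unfolding mse_def by measurable
  \<comment> \<open>Integrability of the excess error is known only for large \<open>N\<close>,
    hence the premise; without it \<open>\<epsilon> N\<close> could be the default value 0.\<close>
  have Vhat: "integrable P (\<lambda>\<omega>. Vhat N M \<omega> - v)"
    "expectation (\<lambda>\<omega>. \<bar>Vhat N M \<omega> - v\<bar>) \<le> 4 * \<kappa> * v / sqrt (real M) + 4 * \<epsilon> N"
    if M: "M > 0" and int: "integrable P (\<lambda>\<omega>. \<bar>mse P Q Y (f (\<theta>hat (dataset (train N) N \<omega>))) - v\<bar>)" for N M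
  proof -
    let ?S = "\<Pi>\<^sub>M i\<in>{..<N}. borel :: ((real ^ 'n) \<times> (real ^ 'm)) measure"
    let ?T = "\<Pi>\<^sub>M i\<in>{..<M}. borel :: ((real ^ 'n) \<times> (real ^ 'm)) measure"
    \<comment> \<open>Independence is formulated for tuples over finite index sets;
      \<open>map_restrict_upt\<close> recovers the datasets from them.\<close>
    define X where "X = (\<lambda>\<omega>. \<lambda>i\<in>{..<N}. train N i \<omega>)"
    define W where "W = (\<lambda>\<omega>. \<lambda>i\<in>{..<M}. test M i \<omega>)"
    define t where "t = (\<lambda>z. \<theta>hat (map z [0..<N]))"
    define F where "F = (\<lambda>p. mse_hat (f (t (fst p))) (map (snd p) [0..<M]) - v)"
    \<comment> \<open>No absolute value is needed, as \<open>mse_ge\<close> makes the excess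
      nonnegative; averaging it over the training tuple gives \<open>\<epsilon> N\<close>.\<close>
    define G where "G = (\<lambda>z. 4 * \<kappa> * v / sqrt (real M) + 4 * (mse P Q Y (f (t z)) - v))"
    have ind: "indep_var ?S X ?T W"
      using indep[of N M] by (simp add: indep_datasets_def X_def W_def)
    have t [measurable]: "t \<in> ?S \<rightarrow>\<^sub>M borel" using theta_meas[of N] by (simp add: t_def)
    \<comment> \<open>The fitted parameter varies with the training tuple, so joint measurability of
      \<open>f\<close> in parameter and argument is essential.\<close>
    have F_meas: "F \<in> borel_measurable (?S \<Otimes>\<^sub>M ?T)"
    proof -
      have comp: "(\<lambda>p. snd p i) \<in> (?S \<Otimes>\<^sub>M ?T) \<rightarrow>\<^sub>M borel" if "i < M" for i
        using that by (intro measurable_compose[OF measurable_snd measurable_component_singleton]) simp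
      have "(\<lambda>p. f (t (fst p)) (snd (snd p i))) \<in> borel_measurable (?S \<Otimes>\<^sub>M ?T)" if "i < M" for i
      proof -
        note [measurable] = comp[OF that]
        have "(\<lambda>p. (t (fst p), snd (snd p i))) \<in> (?S \<Otimes>\<^sub>M ?T) \<rightarrow>\<^sub>M borel \<Otimes>\<^sub>M borel"
          by measurable
        from measurable_compose[OF this f_meas] show ?thesis by simp
      qed
      moreover have "(\<lambda>p. fst (snd p i)) \<in> borel_measurable (?S \<Otimes>\<^sub>M ?T)" if "i < M" for i
        using comp[OF that] by measurable
      ultimately show ?thesis
        unfolding F_def mse_hat_map
        by (intro borel_measurable_diff borel_measurable_divide borel_measurable_sum
            borel_measurable_power borel_measurable_norm) auto
    qed
    have G_meas: "G \<in> borel_measurable ?S"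
      unfolding G_def using measurable_compose[OF t mse_meas] by simp
    have tX: "t (X \<omega>) = \<theta>hat (dataset (train N) N \<omega>)" for \<omega>
      by (simp only: t_def X_def map_restrict_upt)
    have FW: "F (x, W \<omega>) = mse_hat (f (t x)) (dataset (test M) M \<omega>) - v" for x \<omega>
      by (simp only: F_def W_def map_restrict_upt fst_conv snd_conv)
    have GX: "G (X \<omega>) = 4 * \<kappa> * v / sqrt (real M)
        + 4 * \<bar>mse P Q Y (f (\<theta>hat (dataset (train N) N \<omega>))) - v\<bar>" for \<omega>
      using mse_ge by (simp add: G_def tX)
    have iG: "integrable P (\<lambda>\<omega>. G (X \<omega>))" unfolding GX using int by simp
    \<comment> \<open>With the training tuple frozen, \<open>f (t x)\<close> is a fixed member of
      \<open>range f\<close>, and \<open>dev\<close> applies to the test samples.\<close>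
    have F1: "integrable P (\<lambda>\<omega>. \<bar>F (x, W \<omega>)\<bar>)" "expectation (\<lambda>\<omega>. \<bar>F (x, W \<omega>)\<bar>) \<le> G x" for x
      using dev[OF _ test M, of "f (t x)"] unfolding FW G_def v_def by auto
    note * = indep_var_expectation_le[OF prob ind F_meas G_meas iG F1]
    have FXW: "F (X \<omega>, W \<omega>) = Vhat N M \<omega> - v" for \<omega> by (simp add: FW tX Vhat_def)
    show "integrable P (\<lambda>\<omega>. Vhat N M \<omega> - v)" using *(1) by (simp add: FXW)
    have "expectation (\<lambda>\<omega>. G (X \<omega>)) = 4 * \<kappa> * v / sqrt (real M) + 4 * \<epsilon> N"
      unfolding GX \<epsilon>_def using int by (simp add: prob_space)
    then show "expectation (\<lambda>\<omega>. \<bar>Vhat N M \<omega> - v\<bar>) \<le> 4 * \<kappa> * v / sqrt (real M) + 4 * \<epsilon> N"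
      using *(2) by (simp add: FXW)
  qed
  from opt obtain c where c: "c > 0"
    and opt_c: "\<forall>\<^sub>F N in sequentially. norm (\<epsilon> N)
      \<le> c * norm (\<integral>\<omega>. \<bar>mse_hat (f \<theta>star) (dataset (train N) N \<omega>) - v\<bar> \<partial>P)"
    unfolding \<epsilon>_def v_def by (elim landau_o.bigE)
  \<comment> \<open>For \<open>f \<theta>star\<close> itself the excess term in \<open>dev\<close>
    is 0, which leaves only the rate in \<open>N\<close>.\<close>
  have "\<forall>\<^sub>F N in sequentially. \<epsilon> N \<le> c * (4 * \<kappa> * v / sqrt (real N))"
    using opt_c eventually_gt_at_top[of 0]
  proof eventually_elim
    case (elim N)
    have "\<epsilon> N \<le> c * (\<integral>\<omega>. \<bar>mse_hat (f \<theta>star) (dataset (train N) N \<omega>) - v\<bar> \<partial>P)"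
      using elim by (simp add: \<epsilon>_def)
    also have "\<dots> \<le> c * (4 * \<kappa> * v / sqrt (real N))"
      using dev(2)[OF _ train elim(2), of "f \<theta>star"] c by (intro mult_left_mono) (auto simp: v_def)
    finally show ?case .
  qed
  with opt_integrable have "\<forall>\<^sub>F N in sequentially. \<epsilon> N \<le> c * (4 * \<kappa> * v / sqrt (real N)) \<and>
      integrable P (\<lambda>\<omega>. \<bar>mse P Q Y (f (\<theta>hat (dataset (train N) N \<omega>))) - v\<bar>)"
    unfolding v_def by (rule eventually_elim2) simp
  from eventually_prodI[OF this eventually_gt_at_top[of "0 :: nat"]]
  have ev: "\<forall>\<^sub>F p in sequentially \<times>\<^sub>F sequentially. \<epsilon> (fst p) \<le> c * (4 * \<kappa> * v / sqrt (real (fst p))) \<and>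
      integrable P (\<lambda>\<omega>. Vhat (fst p) (snd p) \<omega> - v) \<and>
      expectation (\<lambda>\<omega>. \<bar>Vhat (fst p) (snd p) \<omega> - v\<bar>)
        \<le> 4 * \<kappa> * v / sqrt (real (snd p)) + 4 * \<epsilon> (fst p)"
    by (rule eventually_mono) (use Vhat in auto)
  have int_V: "integrable P (\<lambda>\<omega>. \<bar>Vhat N M \<omega> - V\<bar>)" if "integrable P (\<lambda>\<omega>. Vhat N M \<omega> - v)" for N M
  proof -
    have shift: "Vhat N M \<omega> - V = (Vhat N M \<omega> - v) + (v - V)" for \<omega> by simp
    show ?thesis
      unfolding shift using that by (intro integrable_abs Bochner_Integration.integrable_add) simp_all
  qed
  \<comment> \<open>The constant \<open>\<bar>v - V\<bar>\<close> moves inside the expectation,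
    where the reverse triangle inequality holds pointwise.\<close>
  have diff: "\<bar>expectation (\<lambda>\<omega>. \<bar>Vhat N M \<omega> - V\<bar>) - \<bar>v - V\<bar>\<bar> \<le> expectation (\<lambda>\<omega>. \<bar>Vhat N M \<omega> - v\<bar>)"
    if "integrable P (\<lambda>\<omega>. Vhat N M \<omega> - v)" for N M
  proof -
    have "expectation (\<lambda>\<omega>. \<bar>Vhat N M \<omega> - V\<bar>) - \<bar>v - V\<bar> = expectation (\<lambda>\<omega>. \<bar>Vhat N M \<omega> - V\<bar> - \<bar>v - V\<bar>)"
      using int_V[OF that] by (simp add: prob_space)
    also have "\<bar>\<dots>\<bar> \<le> expectation (\<lambda>\<omega>. \<bar>\<bar>Vhat N M \<omega> - V\<bar> - \<bar>v - V\<bar>\<bar>)" by (rule integral_abs_bound)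
    also have "\<dots> \<le> expectation (\<lambda>\<omega>. \<bar>Vhat N M \<omega> - v\<bar>)"
      using that int_V[OF that] by (intro integral_mono) auto
    finally show ?thesis .
  qed
  \<comment> \<open>The factor \<open>2 * sqrt pi\<close> turns the \<open>2 / sqrt pi\<close> of
    the stated rate into 4, and \<open>1 + 4 * c\<close> dominates both the coefficient 1 of the
    test term and \<open>4 * c\<close> of the training term.\<close>
  define K where "K = 2 * sqrt pi * \<kappa> * (1 + 4 * c)"
  have rate: "4 * \<kappa> * v / sqrt (real M) + 4 * (c * (4 * \<kappa> * v / sqrt (real N)))
      \<le> K * \<bar>(2 / sqrt (pi * real N) + 2 / sqrt (pi * real M)) * v\<bar>" for N M
  proof -
    have "K * \<bar>(2 / sqrt (pi * real N) + 2 / sqrt (pi * real M)) * v\<bar>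
        = 4 * \<kappa> * (1 + 4 * c) * (1 / sqrt (real N) + 1 / sqrt (real M)) * v"
    proof -
      have "2 / sqrt (pi * real k) = 2 / sqrt pi * (1 / sqrt (real k))" for k
        by (simp add: real_sqrt_mult)
      then have "K * \<bar>(2 / sqrt (pi * real N) + 2 / sqrt (pi * real M)) * v\<bar>
          = K * (2 / sqrt pi) * (1 / sqrt (real N) + 1 / sqrt (real M)) * v"
        using v0 by (simp add: abs_mult algebra_simps)
      also have "K * (2 / sqrt pi) = 4 * \<kappa> * (1 + 4 * c)" by (simp add: K_def)
      finally show ?thesis .
    qed
    \<comment> \<open>The surplus is the wanted expression with \<open>N\<close> and
      \<open>M\<close> exchanged, hence nonnegative.\<close>
    also have "\<dots> = (4 * \<kappa> * v / sqrt (real M) + 4 * (c * (4 * \<kappa> * v / sqrt (real N))))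
        + (4 * \<kappa> * v / sqrt (real N) + 4 * (c * (4 * \<kappa> * v / sqrt (real M))))"
      by (simp add: algebra_simps add_divide_distrib)
    finally show ?thesis using \<kappa>(2) v0 c by simp
  qed
  have "\<forall>\<^sub>F p in sequentially \<times>\<^sub>F sequentially. integrable P (\<lambda>\<omega>. \<bar>Vhat (fst p) (snd p) \<omega> - V\<bar>)"
    using ev by (rule eventually_mono) (use int_V in blast)
  moreover have "(\<lambda>p. expectation (\<lambda>\<omega>. \<bar>Vhat (fst p) (snd p) \<omega> - V\<bar>) - \<bar>v - V\<bar>)
      \<in> O[sequentially \<times>\<^sub>F sequentially](\<lambda>p. (2 / sqrt (pi * real (fst p)) + 2 / sqrt (pi * real (snd p))) * v)"
  proof (rule bigoI[of _ K])
    show "\<forall>\<^sub>F p in sequentially \<times>\<^sub>F sequentially.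
      norm (expectation (\<lambda>\<omega>. \<bar>Vhat (fst p) (snd p) \<omega> - V\<bar>) - \<bar>v - V\<bar>)
      \<le> K * norm ((2 / sqrt (pi * real (fst p)) + 2 / sqrt (pi * real (snd p))) * v)"
      using ev
    proof eventually_elim
      case (elim p)
      then show ?case
        using diff[of "fst p" "snd p"] rate[of "snd p" "fst p"] by simp
    qed
  qed
  ultimately show ?thesis
    unfolding V by (simp add: Vhat_def v_def V_def case_prod_unfold)
qed

end
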